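(* There is a bijection between the set of standard Young $m$-tableaux of size $n$ and the set $\mathrm{Cont}_m(n)$.
   Context: Parameters. Let $m,n\ge 1$. Either $K=\mathbb{C}(q,v_1,\dots,v_m)$ with $q,v_1,\dots,v_m$ indeterminates, or $K=\mathbb{C}$ and $q,v_1,\dots,v_m\in\mathbb{C}$, $q\neq0$, satisfy: $1+q^2+\dots+q^{2N}\neq0$ for all non-negative integers $N<n$; $q^{2i}v_j-v_k\neq0$ for all $i,j,k$ with $j\neq k$ and $-n<i<n$; $v_j\neq0$ for all $j=1,\dots,m$. Content strings. A content string $(a_1,\dots,a_n)$ is a string of numbers (elements of $K$) satisfying the following conditions: (c1) $a_1\in\{v_1,\dots,v_m\}$; (c2) for all $j>1$: if $a_j=v_kq^{2z}$ for some $k$ and some integer $z\neq0$, then $\{v_kq^{2(z-1)},v_kq^{2(z+1)}\}\cap\{a_1,\dots,a_{j-1}\}\neq\varnothing$; (c3) if $a_i=a_j=v_kq^{2z}$ with $i<j$ for some $k$ and some integer $z$, then $\{v_kq^{2(z-1)},v_kq^{2(z+1)}\}\subset\{a_{i+1},\dots,a_{j-1}\}$. $\mathrm{Cont}_m(n)$ is the set of content strings of length $n$. Tableaux. An $m$-partition of $n$ is an $m$-tuple of partitions (Young diagrams) of total size $n$. A standard Young $m$-tableau of size $n$ is a bijective filling with $1,\dots,n$ of the nodes of an $m$-partition of $n$ such that in every diagram the numbers increase along rows (to the right) and columns (downwards).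
   Formalization: Content-string entries must have the form v_k q^{2z}; (c2) is imposed only on entries a_j different from all of v_1,…,v_m; for complex parameters with n≥2, q^2≠1 is also assumed. Otherwise the claim fails (e.g. infinitely many strings (v_1,x), or q^2=1, m=1, n=2). *)

theory Defs
  imports
    Complex_Main
    "HOL-Library.FuncSet"
    "HOL-Library.Poly_Mapping"
    "HOL-Computational_Algebra.Fraction_Field"
begin

section \<open>Parameters\<close>

text \<open>
  Polynomials over the complex numbers in the indeterminates \<open>x\<^sub>0, x\<^sub>1, \<dots>\<close> are finitely
  supported maps from monomials to coefficients, a monomial being a finitely supported map
  from variable indices to exponents.
\<close>

type_synonym cpoly = "(nat \<Rightarrow>\<^sub>0 nat) \<Rightarrow>\<^sub>0 complex"

type_synonym cratfun = "cpoly fract"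

definition indet :: "nat \<Rightarrow> cratfun" where
  "indet i = Fract (Poly_Mapping.single (Poly_Mapping.single i 1) 1) 1"

definition polys_in :: "nat \<Rightarrow> cpoly set" where
  "polys_in m = {f. \<forall>\<mu>\<in>Poly_Mapping.keys f. Poly_Mapping.keys \<mu> \<subseteq> {0..m}}"

text \<open>
  The field of rational functions in \<open>q, v\<^sub>1, \<dots>, v\<^sub>m\<close>, where \<open>q = x\<^sub>0\<close> and \<open>v\<^sub>j = x\<^sub>j\<close>,
  as a subfield of the rational functions in all the \<open>x\<^sub>i\<close>.
\<close>

definition ratfuns :: "nat \<Rightarrow> cratfun set" where
  "ratfuns m = {Fract f g | f g. f \<in> polys_in m \<and> g \<in> polys_in m \<and> g \<noteq> 0}"

text \<open>
  These conditions admit \<open>q\<^sup>2 = 1\<close>, where \<open>v\<^sub>k q\<^sup>2\<^sup>z\<close> does not depend on \<open>z\<close>.  Contents then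
  cannot tell apart the nodes of a diagram and, for \<open>n \<ge> 2\<close>, there are fewer content strings
  than tableaux, so \<open>q\<^sup>2 = 1\<close> has to be excluded separately.
\<close>

definition complex_parameters :: "nat \<Rightarrow> nat \<Rightarrow> complex \<Rightarrow> (nat \<Rightarrow> complex) \<Rightarrow> bool" where
  "complex_parameters m n q v \<longleftrightarrow>
     q \<noteq> 0 \<and>
     (\<forall>N<n. (\<Sum>i=0..N. q ^ (2 * i)) \<noteq> 0) \<and>
     (\<forall>j\<in>{1..m}. \<forall>k\<in>{1..m}. \<forall>i::int. j \<noteq> k \<longrightarrow> - int n < i \<longrightarrow> i < int n \<longrightarrow>
        q powi (2 * i) * v j - v k \<noteq> 0) \<and>
     (\<forall>j\<in>{1..m}. v j \<noteq> 0)"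


section \<open>Content strings\<close>

text \<open>
  The string \<open>(a\<^sub>1, \<dots>, a\<^sub>n)\<close> is the list \<open>a\<close> with \<open>a\<^sub>j = a ! (j - 1)\<close>; the bound variables
  \<open>i\<close> and \<open>j\<close> below are list positions and start from 0.

  All entries are required to be of the form \<open>v\<^sub>k q\<^sup>2\<^sup>z\<close>; conditions (c2) and (c3) say nothing
  about other numbers.  In (c2), \<open>z \<noteq> 0\<close> is meant to single out the entries different from
  every \<open>v\<^sub>k\<close>.  For indeterminates the two are the same.  For complex parameters the exponent
  need not be unique (\<open>q\<close> may be a root of unity, or \<open>v\<^sub>j = v\<^sub>k q\<^sup>2\<^sup>z\<close> with \<open>\<bar>z\<bar> \<ge> n\<close>), so that
  some \<open>v\<^sub>j\<close> may also be written with a nonzero exponent; no neighbour is then required.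
\<close>

definition content_string ::
    "'a::field set \<Rightarrow> 'a \<Rightarrow> (nat \<Rightarrow> 'a) \<Rightarrow> nat \<Rightarrow> 'a list \<Rightarrow> bool" where
  "content_string K q v m a \<longleftrightarrow>
     set a \<subseteq> K \<and>
     (\<forall>x\<in>set a. \<exists>k\<in>{1..m}. \<exists>z::int. x = v k * q powi (2 * z)) \<and>
     (a \<noteq> [] \<longrightarrow> a ! 0 \<in> v ` {1..m}) \<and>
     (\<forall>j k (z::int).
        0 < j \<longrightarrow> j < length a \<longrightarrow> k \<in> {1..m} \<longrightarrow> z \<noteq> 0 \<longrightarrow>
        a ! j = v k * q powi (2 * z) \<longrightarrow> a ! j \<notin> v ` {1..m} \<longrightarrow>
        {v k * q powi (2 * (z - 1)), v k * q powi (2 * (z + 1))} \<inter> (!) a ` {0..<j} \<noteq> {}) \<and>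
     (\<forall>i j k (z::int).
        i < j \<longrightarrow> j < length a \<longrightarrow> k \<in> {1..m} \<longrightarrow>
        a ! i = a ! j \<longrightarrow> a ! j = v k * q powi (2 * z) \<longrightarrow>
        {v k * q powi (2 * (z - 1)), v k * q powi (2 * (z + 1))} \<subseteq> (!) a ` {i<..<j})"

definition Cont ::
    "'a::field set \<Rightarrow> 'a \<Rightarrow> (nat \<Rightarrow> 'a) \<Rightarrow> nat \<Rightarrow> nat \<Rightarrow> 'a list set" where
  "Cont K q v m n = {a. length a = n \<and> content_string K q v m a}"


section \<open>Tableaux\<close>

definition is_partition :: "nat list \<Rightarrow> bool" where
  "is_partition p \<longleftrightarrow> sorted_wrt (\<ge>) p \<and> 0 \<notin> set p"

definition mpartitions :: "nat \<Rightarrow> nat \<Rightarrow> nat list list set" where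
  "mpartitions m n =
     {L. length L = m \<and> (\<forall>p\<in>set L. is_partition p) \<and> sum_list (map sum_list L) = n}"

text \<open>A node is a triple of diagram index, row and column, each starting from 0.\<close>

definition nodes :: "nat list list \<Rightarrow> (nat \<times> nat \<times> nat) set" where
  "nodes L = {(k, r, c). k < length L \<and> r < length (L ! k) \<and> c < L ! k ! r}"

definition standard_filling ::
    "nat \<Rightarrow> nat list list \<Rightarrow> (nat \<times> nat \<times> nat \<Rightarrow> nat) \<Rightarrow> bool" where
  "standard_filling n L t \<longleftrightarrow>
     t \<in> extensional (nodes L) \<and>
     bij_betw t (nodes L) {1..n} \<and>
     (\<forall>k r c c'. (k, r, c) \<in> nodes L \<longrightarrow> (k, r, c') \<in> nodes L \<longrightarrow> c < c' \<longrightarrow>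
        t (k, r, c) < t (k, r, c')) \<and>
     (\<forall>k r r' c. (k, r, c) \<in> nodes L \<longrightarrow> (k, r', c) \<in> nodes L \<longrightarrow> r < r' \<longrightarrow>
        t (k, r, c) < t (k, r', c))"

definition std_tableaux ::
    "nat \<Rightarrow> nat \<Rightarrow> (nat list list \<times> (nat \<times> nat \<times> nat \<Rightarrow> nat)) set" where
  "std_tableaux m n = {(L, t). L \<in> mpartitions m n \<and> standard_filling n L t}"

end

theory Submission
  imports Defs
begin

text \<open>
  Record a standard tableau by the list of its nodes in the order of their numbers; these are the
  lists of nodes which can be built by adding one addable node at a time.  Replace each node by
  its diagram and its integral content (column minus row), and then by the value
  \<open>v\<^sub>k q\<^sup>2\<^sup>z\<close>.  At each of these two passages the possible extensions of a list
  correspond bijectively to the possible extensions of its image, so the lists do as well.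

  For the first passage: an addable node is determined by its content, and conditions (c2) and
  (c3) say exactly that the next node on the diagonal \<open>z\<close> has its upper and left neighbours in the
  diagram.  For the second: together with \<open>z\<close>, the integral contents of one diagram contain all
  integers between \<open>0\<close> and \<open>z\<close>, so contents that occur together are too close for the
  restrictions on the parameters to let their values coincide.
\<close>

section \<open>Lists built by one-step extensions\<close>

definition stepwise :: "('a list \<Rightarrow> 'a \<Rightarrow> bool) \<Rightarrow> 'a list \<Rightarrow> bool" where
  "stepwise E xs \<longleftrightarrow> (\<forall>i<length xs. E (take i xs) (xs ! i))"

lemma stepwise_Nil [simp]: "stepwise E []"
  by (simp add: stepwise_def)

lemma stepwise_snoc [simp]: "stepwise E (xs @ [x]) \<longleftrightarrow> stepwise E xs \<and> E xs x"
  by (auto simp: stepwise_def nth_append less_Suc_eq)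

lemma stepwise_take: "stepwise E xs \<Longrightarrow> stepwise E (take i xs)"
  by (auto simp: stepwise_def min_def)

lemma stepwise_nth: "stepwise E xs \<Longrightarrow> i < length xs \<Longrightarrow> E (take i xs) (xs ! i)"
  by (simp add: stepwise_def)

text \<open>Induction on the length: prefixes correspond by the induction hypothesis, last entries
  by the assumption. Only prefixes shorter than \<open>n\<close> are considered, because the
  restrictions on the parameters separate values only in short lists.\<close>

lemma bij_betw_stepwise:
  assumes "\<And>s. stepwise E s \<Longrightarrow> length s < n \<Longrightarrow> bij_betw h {x. E s x} {y. E' (map h s) y}"
  shows "bij_betw (map h) {s. stepwise E s \<and> length s = n} {s. stepwise E' s \<and> length s = n}"
proof -
  have "bij_betw (map h) {s. stepwise E s \<and> length s = l} {s. stepwise E' s \<and> length s = l}"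
    if "l \<le> n" for l
    using that
  proof (induction l)
    case 0
    have "{s. stepwise E s \<and> length s = 0} = {[]}" "{s. stepwise E' s \<and> length s = 0} = {[]}"
      by auto
    then show ?case by (simp add: bij_betw_def)
  next
    case (Suc l)
    then have IH: "bij_betw (map h) {s. stepwise E s \<and> length s = l} {s. stepwise E' s \<and> length s = l}"
      by simp
    have ext: "bij_betw h {x. E s x} {y. E' (map h s) y}" if "stepwise E s" "length s = l" for s
      using assms[of s] that Suc.prems by simp
    have image: "stepwise E' (map h s)" if "stepwise E s" "length s = l" for s
      using bij_betwE[OF IH] that by auto
    show ?case
    proof (rule bij_betw_imageI)
      show "inj_on (map h) {s. stepwise E s \<and> length s = Suc l}"
      proof (rule inj_onI)
        fix t t'
        assume "t \<in> {s. stepwise E s \<and> length s = Suc l}" "t' \<in> {s. stepwise E s \<and> length s = Suc l}"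
          and eq: "map h t = map h t'"
        then obtain s x s' x' where t: "t = s @ [x]" "stepwise E s" "E s x" "length s = l"
          and t': "t' = s' @ [x']" "stepwise E s'" "E s' x'" "length s' = l"
          by (auto simp: length_Suc_conv_rev)
        then have "s' = s"
          using inj_onD[OF bij_betw_imp_inj_on[OF IH], of s' s] eq by auto
        then show "t = t'"
          using inj_onD[OF bij_betw_imp_inj_on[OF ext[of s]], of x x'] t t' eq by simp
      qed
      show "map h ` {s. stepwise E s \<and> length s = Suc l} = {s. stepwise E' s \<and> length s = Suc l}"
      proof (intro equalityI subsetI)
        fix t assume "t \<in> map h ` {s. stepwise E s \<and> length s = Suc l}"
        then obtain s x where s: "t = map h (s @ [x])" "stepwise E s" "E s x" "length s = l"
          by (auto simp: length_Suc_conv_rev)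
        then have "E' (map h s) (h x)"
          using bij_betwE[OF ext[of s]] by auto
        then show "t \<in> {s. stepwise E' s \<and> length s = Suc l}"
          using s image[of s] by simp
      next
        fix t assume "t \<in> {s. stepwise E' s \<and> length s = Suc l}"
        then obtain t' y where t: "t = t' @ [y]" "stepwise E' t'" "E' t' y" "length t' = l"
          by (auto simp: length_Suc_conv_rev)
        then have "t' \<in> map h ` {s. stepwise E s \<and> length s = l}"
          using bij_betw_imp_surj_on[OF IH] by simp
        then obtain s where s: "t' = map h s" "stepwise E s" "length s = l"
          by auto
        then have "y \<in> h ` {x. E s x}"
          using bij_betw_imp_surj_on[OF ext[of s]] t by simp
        then show "t \<in> map h ` {s. stepwise E s \<and> length s = Suc l}"
          using s t by (auto intro!: image_eqI[where x = "s @ [_]"])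
      qed
    qed
  qed
  then show ?thesis by simp
qed

lemma set_drop_conv_nth: "set (drop i s) = {s ! j | j. i \<le> j \<and> j < length s}"
proof (intro equalityI subsetI)
  fix x assume "x \<in> {s ! j | j. i \<le> j \<and> j < length s}"
  then obtain j where "x = s ! j" "i \<le> j" "j < length s" by auto
  then show "x \<in> set (drop i s)"
    by (auto simp: in_set_conv_nth intro!: exI[of _ "j - i"])
next
  fix x assume "x \<in> set (drop i s)"
  then show "x \<in> {s ! j | j. i \<le> j \<and> j < length s}"
    by (fastforce simp: in_set_conv_nth)
qed

section \<open>Tableaux as lists of nodes\<close>

text \<open>This makes the node addable to the diagrams formed by \<open>s\<close>. The immediate
  upper and left neighbours suffice, since the remaining nodes to the north-west then
  follow.\<close>

definition node_step :: "nat \<Rightarrow> (nat \<times> nat \<times> nat) list \<Rightarrow> nat \<times> nat \<times> nat \<Rightarrow> bool" where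
  "node_step m s = (\<lambda>(k, r, c). k < m \<and> (k, r, c) \<notin> set s \<and>
     (0 < r \<longrightarrow> (k, r - 1, c) \<in> set s) \<and> (0 < c \<longrightarrow> (k, r, c - 1) \<in> set s))"

text \<open>Neighbours that were present when a node was added stay in the list, so one can walk
  from any node upwards and to the left.\<close>

lemma node_step_down_closed:
  assumes "stepwise (node_step m) s" "(k, r, c) \<in> set s" "r' \<le> r" "c' \<le> c"
  shows "(k, r', c') \<in> set s"
proof -
  have pred: "(0 < r \<longrightarrow> (k, r - 1, c) \<in> set s) \<and> (0 < c \<longrightarrow> (k, r, c - 1) \<in> set s)"
    if "(k, r, c) \<in> set s" for r c
    using assms(1) that by (induction s rule: rev_induct) (auto simp: node_step_def)
  \<comment> \<open>Truncated subtraction keeps the walk at row 0 once it has arrived there, so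
    \<open>d\<close> needs no bound.\<close>
  have row: "(k, r - d, c) \<in> set s" if "(k, r, c) \<in> set s" for d r c
  proof (induction d)
    case (Suc d)
    then show ?case using pred[of "r - d" c] by (cases "r - d = 0") auto
  qed (use that in simp)
  have col: "(k, r, c - d) \<in> set s" if "(k, r, c) \<in> set s" for d r c
  proof (induction d)
    case (Suc d)
    then show ?case using pred[of r "c - d"] by (cases "c - d = 0") auto
  qed (use that in simp)
  show ?thesis
    using col[OF row[OF assms(2), of "r - r'"], of "c - c'"] assms(3,4) by simp
qed

text \<open>If \<open>s ! j\<close> came first, the prefix before position \<open>i\<close>, being
  down-closed, would already contain \<open>s ! i\<close>, which was new when it was added.\<close>

lemma node_step_index_less:
  assumes "stepwise (node_step m) s" "i < length s" "s ! i = (k, r', c')" "j < length s"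
    "s ! j = (k, r, c)" "r' \<le> r" "c' \<le> c"
  shows "i \<le> j"
proof (rule ccontr)
  assume "\<not> i \<le> j"
  then have "s ! j \<in> set (take i s)"
    using assms(4) by (auto simp: in_set_conv_nth)
  then have "s ! i \<in> set (take i s)"
    using node_step_down_closed[OF stepwise_take[OF assms(1)]] assms by metis
  then show False
    using stepwise_nth[OF assms(1,2)] by (auto simp: node_step_def)
qed

lemma node_step_distinct: "stepwise (node_step m) s \<Longrightarrow> distinct s"
  by (induction s rule: rev_induct) (auto simp: node_step_def)

section \<open>Diagrams as finite down-closed sets of nodes\<close>

lemma nodes_eq_Sigma: "nodes L = (SIGMA k:{..<length L}. SIGMA r:{..<length (L ! k)}. {..<L ! k ! r})"
  by (auto simp: nodes_def)

lemma card_nodes: "card (nodes L) = sum_list (map sum_list L)"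
  by (simp add: nodes_eq_Sigma card_SigmaI sum_list_sum_nth atLeast0LessThan)

lemma is_partition_nth_pos: "is_partition p \<Longrightarrow> r < length p \<Longrightarrow> 0 < p ! r"
  by (metis is_partition_def not_gr_zero nth_mem)

lemma partition_eqI:
  assumes p: "is_partition p" "is_partition p'"
    and eq: "\<And>r c. r < length p \<and> c < p ! r \<longleftrightarrow> r < length p' \<and> c < p' ! r"
  shows "p = p'"
proof (rule nth_equalityI)
  \<comment> \<open>Parts are positive, so a row exists exactly when it has a node in column
    0.\<close>
  have "r < length p \<longleftrightarrow> r < length p'" for r
    using eq[of r 0] is_partition_nth_pos p by blast
  then show "length p = length p'" by (metis linorder_neq_iff)
  fix r assume "r < length p"
  then have "c < p ! r \<longleftrightarrow> c < p' ! r" for c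
    using eq[of r c] \<open>length p = length p'\<close> by auto
  then show "p ! r = p' ! r" by (metis linorder_neq_iff)
qed

lemma inj_on_nodes: "inj_on nodes (mpartitions m n)"
proof (rule inj_onI)
  fix L L' assume L: "L \<in> mpartitions m n" "L' \<in> mpartitions m n" and eq: "nodes L = nodes L'"
  show "L = L'"
  proof (rule nth_equalityI)
    show "length L = length L'" using L by (simp add: mpartitions_def)
    fix k assume k: "k < length L"
    show "L ! k = L' ! k"
    proof (rule partition_eqI)
      show "is_partition (L ! k)" "is_partition (L' ! k)"
        using L k by (auto simp: mpartitions_def)
      fix r c
      have "(k, r, c) \<in> nodes L \<longleftrightarrow> (k, r, c) \<in> nodes L'" using eq by simp
      then show "r < length (L ! k) \<and> c < L ! k ! r \<longleftrightarrow> r < length (L' ! k) \<and> c < L' ! k ! r"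
        using k \<open>length L = length L'\<close> by (simp add: nodes_def)
    qed
  qed
qed

lemma nodes_down_closed:
  assumes L: "L \<in> mpartitions m n" and "(k, r, c) \<in> nodes L" "r' \<le> r" "c' \<le> c"
  shows "(k, r', c') \<in> nodes L"
proof -
  have k: "k < length L" "r < length (L ! k)" "c < L ! k ! r"
    using assms(2) by (auto simp: nodes_def)
  then have "sorted_wrt (\<ge>) (L ! k)"
    using L by (auto simp: mpartitions_def is_partition_def)
  then have "L ! k ! r \<le> L ! k ! r'"
    using sorted_wrt_nth_less[of "(\<ge>)" "L ! k" r' r] k assms(3) by (cases "r' = r") auto
  then show ?thesis using k assms(3,4) by (auto simp: nodes_def)
qed

text \<open>An element \<open>x\<close> brings all of \<open>{..x}\<close> with it and is therefore
  smaller than the cardinality. So \<open>A\<close> lies in an initial segment of its own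
  size.\<close>

lemma down_closed_eq_lessThan_card:
  fixes A :: "nat set"
  assumes "finite A" "\<And>x y. x \<in> A \<Longrightarrow> y \<le> x \<Longrightarrow> y \<in> A"
  shows "A = {..<card A}"
proof -
  have "{..x} \<subseteq> A" if "x \<in> A" for x using assms(2) that by auto
  then have "x < card A" if "x \<in> A" for x
    using card_mono[OF assms(1), of "{..x}"] that by fastforce
  then have "A \<subseteq> {..<card A}" by auto
  then show ?thesis by (intro card_subset_eq) auto
qed

text \<open>Every row and every first column of a down-closed set is an initial segment, so
  cardinalities recover the row lengths and the numbers of rows.\<close>

lemma down_closed_eq_nodes:
  assumes D: "finite D" and k: "\<And>k r c. (k, r, c) \<in> D \<Longrightarrow> k < m"
    and down: "\<And>k r c r' c'. (k, r, c) \<in> D \<Longrightarrow> r' \<le> r \<Longrightarrow> c' \<le> c \<Longrightarrow> (k, r', c') \<in> D"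
  shows "\<exists>L \<in> mpartitions m (card D). nodes L = D"
proof -
  define row where "row = (\<lambda>k r. card {c. (k, r, c) \<in> D})"
  define rows where "rows = (\<lambda>k. card {r. (k, r, 0) \<in> D})"
  define L where "L = map (\<lambda>k. map (row k) [0..<rows k]) [0..<m]"
  \<comment> \<open>Both slices lie in projections of the finite set \<open>D\<close>.\<close>
  have fin: "finite {c. (k, r, c) \<in> D}" "finite {r. (k, r, 0) \<in> D}" for k r
    by (rule finite_subset[OF _ finite_imageI[OF finite_imageI[OF D, of snd], of snd]], force)
      (rule finite_subset[OF _ finite_imageI[OF finite_imageI[OF D, of snd], of fst]], force)
  have row: "(k, r, c) \<in> D \<longleftrightarrow> c < row k r" for k r c
  proof -
    have "{c. (k, r, c) \<in> D} = {..<row k r}"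
      unfolding row_def by (rule down_closed_eq_lessThan_card[OF fin(1)]) (auto intro: down)
    then show ?thesis by blast
  qed
  have rows: "(k, r, 0) \<in> D \<longleftrightarrow> r < rows k" for k r
  proof -
    have "{r. (k, r, 0) \<in> D} = {..<rows k}"
      unfolding rows_def by (rule down_closed_eq_lessThan_card[OF fin(2)]) (auto intro: down)
    then show ?thesis by blast
  qed
  have "(k, r, c) \<in> nodes L \<longleftrightarrow> k < m \<and> r < rows k \<and> c < row k r" for k r c
    by (auto simp: nodes_def L_def)
  moreover have "(k, r, c) \<in> D \<longleftrightarrow> k < m \<and> r < rows k \<and> c < row k r" for k r c
    using k row rows down[of k r c r 0] by auto
  ultimately have nodes: "nodes L = D" by auto
  have "is_partition (map (row k) [0..<rows k])" for k
  proof -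
    have "row k r' \<le> row k r" if "r \<le> r'" for r r'
      unfolding row_def using that by (intro card_mono fin) (auto intro: down)
    moreover have "row k r \<noteq> 0" if "r < rows k" for r
      using that row[of k r 0] rows by auto
    ultimately show ?thesis
      by (force simp: is_partition_def sorted_wrt_map sorted_wrt_iff_nth_less)
  qed
  then have "L \<in> mpartitions m (card D)"
    using card_nodes[of L] nodes by (auto simp: mpartitions_def L_def)
  then show ?thesis using nodes by blast
qed

section \<open>Standard tableaux and their lists of nodes\<close>

definition node_list :: "nat \<Rightarrow> nat list list \<times> (nat \<times> nat \<times> nat \<Rightarrow> nat) \<Rightarrow> (nat \<times> nat \<times> nat) list" where
  "node_list n = (\<lambda>(L, t). map (inv_into (nodes L) t) [1..<Suc n])"

lemma length_node_list [simp]: "length (node_list n T) = n"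
  by (simp add: node_list_def split: prod.split)

context
  fixes m n L t assumes T: "(L, t) \<in> std_tableaux m n"
begin

lemma tableau_bij: "bij_betw t (nodes L) {1..n}"
  using T by (simp add: std_tableaux_def standard_filling_def)

lemma node_list_nth:
  "i < n \<Longrightarrow> node_list n (L, t) ! i \<in> nodes L \<and> t (node_list n (L, t) ! i) = Suc i"
  using bij_betw_inv_into_right[OF tableau_bij, of "Suc i"]
    inv_into_into[of "Suc i" t "nodes L"] bij_betw_imp_surj_on[OF tableau_bij]
  by (simp add: node_list_def del: upt_Suc)

text \<open>Fillings number from 1 and list positions start from 0, hence the shift.\<close>

lemma node_list_nth_tableau:
  assumes "x \<in> nodes L"
  shows "t x - 1 < n" "node_list n (L, t) ! (t x - 1) = x"
proof -
  have "t x \<in> {1..n}" using bij_betwE[OF tableau_bij] assms by blast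
  then show *: "t x - 1 < n" by auto
  have "t (node_list n (L, t) ! (t x - 1)) = t x" "node_list n (L, t) ! (t x - 1) \<in> nodes L"
    using node_list_nth[OF *] \<open>t x \<in> {1..n}\<close> by auto
  then show "node_list n (L, t) ! (t x - 1) = x"
    using inj_onD[OF bij_betw_imp_inj_on[OF tableau_bij]] assms by metis
qed

text \<open>This translates being placed earlier into having a smaller number, which turns
  standardness into the condition of \<open>node_step\<close>.\<close>

lemma set_take_node_list: "i \<le> n \<Longrightarrow> set (take i (node_list n (L, t))) = {x \<in> nodes L. t x \<le> i}"
proof (intro equalityI subsetI)
  fix x assume "i \<le> n" "x \<in> set (take i (node_list n (L, t)))"
  then obtain j where "j < i" "x = node_list n (L, t) ! j"
    by (auto simp: in_set_conv_nth)
  then show "x \<in> {x \<in> nodes L. t x \<le> i}"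
    using node_list_nth[of j] \<open>i \<le> n\<close> by auto
next
  fix x assume i: "i \<le> n" and x: "x \<in> {x \<in> nodes L. t x \<le> i}"
  then have "t x \<in> {1..n}" using bij_betwE[OF tableau_bij] by blast
  then have "t x - 1 < i" using x by auto
  then show "x \<in> set (take i (node_list n (L, t)))"
    using node_list_nth_tableau[of x] x i by (auto simp: in_set_conv_nth intro!: exI[of _ "t x - 1"])
qed

lemma set_node_list: "set (node_list n (L, t)) = nodes L"
  using set_take_node_list[of n] bij_betwE[OF tableau_bij] by auto

text \<open>The upper and left neighbours of a node belong to the diagram and carry smaller numbers,
  so they occur in the prefix before it.\<close>

lemma stepwise_node_list: "stepwise (node_step m) (node_list n (L, t))"
  unfolding stepwise_def
proof (intro allI impI)
  fix i assume "i < length (node_list n (L, t))"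
  then have i: "i < n" by simp
  obtain k r c where x: "node_list n (L, t) ! i = (k, r, c)" by (cases "node_list n (L, t) ! i")
  have mem: "(k, r, c) \<in> nodes L" and tx: "t (k, r, c) = Suc i"
    using node_list_nth[OF i] x by auto
  have L: "L \<in> mpartitions m n" and st: "standard_filling n L t"
    using T by (auto simp: std_tableaux_def)
  have "k < m" using mem L by (auto simp: nodes_def mpartitions_def)
  moreover have "(k, r - 1, c) \<in> nodes L \<and> t (k, r - 1, c) \<le> i" if "0 < r"
  proof -
    have "(k, r - 1, c) \<in> nodes L" using nodes_down_closed[OF L mem] by simp
    moreover have "t (k, r - 1, c) < t (k, r, c)"
      using st mem calculation that unfolding standard_filling_def by (metis diff_less zero_less_one)
    ultimately show ?thesis using tx by simp
  qed
  moreover have "(k, r, c - 1) \<in> nodes L \<and> t (k, r, c - 1) \<le> i" if "0 < c"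
  proof -
    have "(k, r, c - 1) \<in> nodes L" using nodes_down_closed[OF L mem] by simp
    moreover have "t (k, r, c - 1) < t (k, r, c)"
      using st mem calculation that unfolding standard_filling_def by (metis diff_less zero_less_one)
    ultimately show ?thesis using tx by simp
  qed
  ultimately show "node_step m (take i (node_list n (L, t))) (node_list n (L, t) ! i)"
    unfolding x node_step_def set_take_node_list[OF less_imp_le[OF i]] using tx by simp
qed

end

lemma inj_on_node_list: "inj_on (node_list n) (std_tableaux m n)"
proof (rule inj_onI, clarify)
  fix L t L' t'
  assume T: "(L, t) \<in> std_tableaux m n" "(L', t') \<in> std_tableaux m n"
    and eq: "node_list n (L, t) = node_list n (L', t')"
  have nodes: "nodes L = nodes L'" using set_node_list T eq by metis
  have LL: "L = L'"
    using inj_onD[OF inj_on_nodes nodes] T by (auto simp: std_tableaux_def)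
  \<comment> \<open>Both fillings are extensional, so it is enough to compare them on the common set
    of nodes.\<close>
  have "t = t'"
  proof (rule extensionalityI)
    show "t \<in> extensional (nodes L)" "t' \<in> extensional (nodes L)"
      using T nodes by (auto simp: std_tableaux_def standard_filling_def)
    fix x assume x: "x \<in> nodes L"
    let ?i = "t x - 1"
    have "t (node_list n (L, t) ! ?i) = Suc ?i" "t' (node_list n (L', t') ! ?i) = Suc ?i"
      using node_list_nth T node_list_nth_tableau[OF T(1) x] by blast+
    then show "t x = t' x" using node_list_nth_tableau[OF T(1) x] eq by simp
  qed
  then show "L = L' \<and> t = t'" using LL by simp
qed

text \<open>The entries of \<open>s\<close> are down-closed and thus form a diagram; numbering each
  by its position gives the filling.\<close>

lemma node_list_surj:
  assumes s: "stepwise (node_step m) s" and n: "length s = n"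
  shows "\<exists>T \<in> std_tableaux m n. node_list n T = s"
proof -
  have "k < m" if "(k, r, c) \<in> set s" for k r c
    using s that by (auto simp: stepwise_def node_step_def in_set_conv_nth)
  then obtain L where L: "L \<in> mpartitions m (card (set s))" "nodes L = set s"
    using down_closed_eq_nodes[of "set s" m] node_step_down_closed[OF s] by auto
  have card: "card (set s) = n" using distinct_card[OF node_step_distinct[OF s]] n by simp
  define g where "g = (\<lambda>i. s ! (i - 1))"
  have g: "bij_betw g {1..n} (set s)"
  proof (rule bij_betw_imageI)
    have "i = j" if "i \<in> {1..n}" "j \<in> {1..n}" "g i = g j" for i j
    proof -
      have "i - 1 = j - 1"
        using nth_eq_iff_index_eq[OF node_step_distinct[OF s], of "i - 1" "j - 1"] that n
        by (auto simp: g_def)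
      then show ?thesis using that by auto
    qed
    then show "inj_on g {1..n}" by (rule inj_onI)
    show "g ` {1..n} = set s"
    proof (intro equalityI subsetI)
      fix x assume "x \<in> set s"
      then obtain i where "i < n" "x = s ! i" using n by (auto simp: in_set_conv_nth)
      then show "x \<in> g ` {1..n}" by (intro image_eqI[of _ _ "Suc i"]) (auto simp: g_def)
    qed (use n in \<open>auto simp: g_def\<close>)
  qed
  \<comment> \<open>The restriction makes the inverse of the enumeration \<open>g\<close>
    extensional.\<close>
  define t where "t = restrict (inv_into {1..n} g) (set s)"
  have t: "bij_betw t (set s) {1..n}"
    unfolding t_def using bij_betw_inv_into[OF g] by (simp cong: bij_betw_cong)
  have t_g: "t (g i) = i" if "i \<in> {1..n}" for i
    using that bij_betw_inv_into_left[OF g that] bij_betwE[OF g] by (simp add: t_def)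
  \<comment> \<open>Weak inequality in both coordinates covers the row condition and the column
    condition at once.\<close>
  have less: "t (k, r', c') < t (k, r, c)"
    if x: "(k, r', c') \<in> set s" "(k, r, c) \<in> set s" and le: "r' \<le> r" "c' \<le> c" and ne: "(r', c') \<noteq> (r, c)"
    for k r c r' c'
  proof -
    obtain i j where ij: "i < n" "s ! i = (k, r', c')" "j < n" "s ! j = (k, r, c)"
      using x n by (auto simp: in_set_conv_nth)
    have "i \<le> j" using node_step_index_less[OF s _ ij(2) _ ij(4) le] ij n by simp
    moreover have "i \<noteq> j" using ij ne by auto
    moreover have "t (k, r', c') = Suc i" "t (k, r, c) = Suc j"
      using t_g[of "Suc i"] t_g[of "Suc j"] ij by (auto simp: g_def)
    ultimately show ?thesis by simp
  qed
  have "standard_filling n L t"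
    unfolding standard_filling_def L(2)
    using t by (auto intro: less) (simp add: t_def)
  then have T: "(L, t) \<in> std_tableaux m n"
    using L(1) card by (simp add: std_tableaux_def)
  have "node_list n (L, t) = s"
  proof (rule nth_equalityI)
    fix i assume "i < length (node_list n (L, t))"
    then have i: "i < n" by simp
    have "t (node_list n (L, t) ! i) = t (s ! i)" "node_list n (L, t) ! i \<in> set s" "s ! i \<in> set s"
      using node_list_nth[OF T i] t_g[of "Suc i"] i n L(2) by (auto simp: g_def)
    then show "node_list n (L, t) ! i = s ! i"
      using inj_onD[OF bij_betw_imp_inj_on[OF t]] by blast
  qed (use n in simp)
  then show ?thesis using T by blast
qed

lemma bij_betw_node_list:
  "bij_betw (node_list n) (std_tableaux m n) {s. stepwise (node_step m) s \<and> length s = n}"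
proof (intro bij_betw_imageI inj_on_node_list equalityI subsetI)
  fix s assume "s \<in> node_list n ` std_tableaux m n"
  then show "s \<in> {s. stepwise (node_step m) s \<and> length s = n}"
    using stepwise_node_list by auto
next
  fix s assume "s \<in> {s. stepwise (node_step m) s \<and> length s = n}"
  then show "s \<in> node_list n ` std_tableaux m n"
    using node_list_surj[of m s n] by auto
qed

section \<open>Integral contents\<close>

text \<open>Diagrams are counted from 0 but the parameters \<open>v\<close> from 1, hence
  \<open>Suc k\<close>.\<close>

definition node_content :: "nat \<times> nat \<times> nat \<Rightarrow> nat \<times> int" where
  "node_content = (\<lambda>(k, r, c). (Suc k, int c - int r))"

text \<open>These are (c1) to (c3) with integral exponents in place of values. For empty
  \<open>s\<close> the second clause forces \<open>z = 0\<close>, which is (c1).\<close>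

definition diag_step :: "nat \<Rightarrow> (nat \<times> int) list \<Rightarrow> nat \<times> int \<Rightarrow> bool" where
  "diag_step m s = (\<lambda>(k, z). k \<in> {1..m} \<and>
     (z \<noteq> 0 \<longrightarrow> (k, z - 1) \<in> set s \<or> (k, z + 1) \<in> set s) \<and>
     (\<forall>i<length s. s ! i = (k, z) \<longrightarrow>
        (k, z - 1) \<in> set (drop (Suc i) s) \<and> (k, z + 1) \<in> set (drop (Suc i) s)))"

text \<open>Off the main diagonal, the left or the upper neighbour supplies (c2). For (c3), an
  earlier node on the same diagonal lies strictly to the north-west, and both neighbours of the new
  node lie south-east of it, hence were added after it.\<close>

lemma diag_step_node_content:
  assumes s: "stepwise (node_step m) s" and x: "node_step m s x"
  shows "diag_step m (map node_content s) (node_content x)"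
proof -
  obtain k r c where [simp]: "x = (k, r, c)" by (cases x)
  have up: "0 < r \<Longrightarrow> (k, r - 1, c) \<in> set s" and left: "0 < c \<Longrightarrow> (k, r, c - 1) \<in> set s"
    using x by (auto simp: node_step_def)
  have "(Suc k, int c - int r - 1) \<in> node_content ` set s" if "r < c"
    using that x by (force simp: node_step_def node_content_def intro!: image_eqI[where x="(k, r, c - 1)"])
  moreover have "(Suc k, int c - int r + 1) \<in> node_content ` set s" if "c < r"
    using that x by (force simp: node_step_def node_content_def intro!: image_eqI[where x="(k, r - 1, c)"])
  moreover have "(Suc k, int c - int r - 1) \<in> set (drop (Suc i) (map node_content s)) \<and>
        (Suc k, int c - int r + 1) \<in> set (drop (Suc i) (map node_content s))"
    if i: "i < length s" "node_content (s ! i) = (Suc k, int c - int r)" for i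
  proof -
    obtain r0 c0 where si: "s ! i = (k, r0, c0)" and eq: "int c - int r = int c0 - int r0"
      using i(2) by (cases "s ! i") (auto simp: node_content_def)
    have "s ! i \<in> set s" using i(1) by simp
    \<comment> \<open>Nodes on one diagonal are comparable; if the earlier one lay to the
      south-east, \<open>x\<close> would already be present.\<close>
    have "r0 < r"
    proof (rule ccontr)
      assume "\<not> r0 < r"
      then have "r \<le> r0" "c \<le> c0" using eq by auto
      then have "x \<in> set s"
        using node_step_down_closed[OF s] \<open>s ! i \<in> set s\<close> si by auto
      then show False using x by (auto simp: node_step_def)
    qed
    then have "c0 < c" using eq by auto
    have later: "y \<in> set (drop (Suc i) s)"
      if "y \<in> set s" "y = (k, r1, c1)" "r0 \<le> r1" "c0 \<le> c1" "y \<noteq> s ! i" for y r1 c1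
    proof -
      obtain j where j: "j < length s" "y = s ! j"
        using \<open>y \<in> set s\<close> by (auto simp: in_set_conv_nth)
      have "i \<le> j"
        using node_step_index_less[OF s i(1) si j(1)] that j by auto
      moreover have "i \<noteq> j" using that j by auto
      ultimately show ?thesis
        using j by (auto simp: set_drop_conv_nth)
    qed
    have "(k, r - 1, c) \<in> set (drop (Suc i) s)" "(k, r, c - 1) \<in> set (drop (Suc i) s)"
      using up left \<open>r0 < r\<close> \<open>c0 < c\<close> si by (auto intro!: later)
    then have "node_content (k, r - 1, c) \<in> node_content ` set (drop (Suc i) s)"
      "node_content (k, r, c - 1) \<in> node_content ` set (drop (Suc i) s)"
      by blast+
    moreover have "node_content (k, r - 1, c) = (Suc k, int c - int r + 1)"
      "node_content (k, r, c - 1) = (Suc k, int c - int r - 1)"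
      using \<open>r0 < r\<close> \<open>c0 < c\<close> by (auto simp: node_content_def)
    ultimately show ?thesis by (simp add: drop_map)
  qed
  moreover have "k < m" using x by (simp add: node_step_def)
  ultimately show ?thesis
    by (auto simp: diag_step_def node_content_def linorder_neq_iff)
qed

text \<open>Of two addable nodes on one diagonal, the lower one needs its upper neighbour, which
  lies south-east of the other node and forces that one to be present already.\<close>

lemma inj_on_node_content:
  assumes s: "stepwise (node_step m) s"
  shows "inj_on node_content {x. node_step m s x}"
proof -
  have "r \<le> r'" if "node_step m s (k, r, c)" "node_step m s (k, r', c')"
    "int c - int r = int c' - int r'" for k r c r' c'
  proof (rule ccontr)
    assume "\<not> r \<le> r'"
    then have "(k, r - 1, c) \<in> set s" "r' \<le> r - 1" "c' \<le> c"
      using that by (auto simp: node_step_def)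
    then have "(k, r', c') \<in> set s"
      using node_step_down_closed[OF s] by blast
    then show False using that by (simp add: node_step_def)
  qed
  note le = this
  show ?thesis
  proof (rule inj_onI; clarsimp simp: node_content_def)
    fix k r c r' c'
    assume "node_step m s (k, r, c)" "node_step m s (k, r', c')" "int c - int r = int c' - int r'"
    then show "r = r' \<and> c = c'"
      using le[of k r c r' c'] le[of k r' c' r c] by auto
  qed
qed

text \<open>If the content has occurred, its last node \<open>(r, c)\<close> is followed by nodes on
  both adjacent diagonals, and \<open>(Suc r, Suc c)\<close> becomes addable. Otherwise the first
  node of the diagonal is addable.\<close>

lemma addable_node_ex:
  assumes s: "stepwise (node_step m) s" and b: "diag_step m (map node_content s) b"
  shows "\<exists>x. node_step m s x \<and> node_content x = b"
proof -
  obtain k z where bk: "b = (Suc k, z)" "k < m"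
    using b by (cases b; cases "fst b") (auto simp: diag_step_def)
  show ?thesis
  proof (cases "\<exists>i<length s. node_content (s ! i) = b")
    case True
    let ?I = "{i. i < length s \<and> node_content (s ! i) = b}"
    define i where "i = Max ?I"
    have "finite ?I" "?I \<noteq> {}" using True by auto
    then have "i \<in> ?I" unfolding i_def by (rule Max_in)
    then have i: "i < length s" "node_content (s ! i) = b" by auto
    have last: "j \<le> i" if "j < length s" "node_content (s ! j) = b" for j
      using \<open>finite ?I\<close> that unfolding i_def by (intro Max_ge) auto
    obtain r c where si: "s ! i = (k, r, c)" and z: "z = int c - int r"
      using i(2) bk by (cases "s ! i") (auto simp: node_content_def)
    \<comment> \<open>A node added after \<open>(r, c)\<close> cannot lie weakly to its north-west.
      On an adjacent diagonal it must then lie at or beyond \<open>(Suc r, c)\<close> or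
      \<open>(r, Suc c)\<close>.\<close>
    have new: "\<exists>r' c'. (k, r', c') \<in> set s \<and> int c' - int r' = z + d \<and> (r < r' \<or> c < c')"
      if "(Suc k, z + d) \<in> set (drop (Suc i) (map node_content s))" for d
    proof -
      have "(Suc k, z + d) \<in> node_content ` set (drop (Suc i) s)"
        using that by (simp add: drop_map)
      then obtain j where j: "i < j" "j < length s" "node_content (s ! j) = (Suc k, z + d)"
        by (auto simp: set_drop_conv_nth Suc_le_eq)
      then obtain r' c' where sj: "s ! j = (k, r', c')" "int c' - int r' = z + d"
        by (cases "s ! j") (auto simp: node_content_def)
      have "r < r' \<or> c < c'"
        using node_step_index_less[OF s j(2) sj(1) i(1) si] j(1) by fastforce
      moreover have "(k, r', c') \<in> set s" using j(2) sj(1) by (metis nth_mem)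
      ultimately show ?thesis using sj(2) by blast
    qed
    have "(Suc k, z - 1) \<in> set (drop (Suc i) (map node_content s))"
      "(Suc k, z + 1) \<in> set (drop (Suc i) (map node_content s))"
      using b i bk by (auto simp: diag_step_def)
    then obtain r1 c1 r2 c2 where
      "(k, r1, c1) \<in> set s" "int c1 - int r1 = z - 1" "r < r1 \<or> c < c1"
      "(k, r2, c2) \<in> set s" "int c2 - int r2 = z + 1" "r < r2 \<or> c < c2"
      using new[of "-1"] new[of 1] by auto
    then have "(k, Suc r, c) \<in> set s" "(k, r, Suc c) \<in> set s"
      using z node_step_down_closed[OF s, of k r1 c1 "Suc r" c]
        node_step_down_closed[OF s, of k r2 c2 r "Suc c"] by auto
    \<comment> \<open>Such a node would be a later occurrence of the same content, contrary to the
      maximality of \<open>i\<close>.\<close>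
    moreover have "(k, Suc r, Suc c) \<notin> set s"
    proof
      assume "(k, Suc r, Suc c) \<in> set s"
      then obtain j where j: "j < length s" "s ! j = (k, Suc r, Suc c)"
        by (auto simp: in_set_conv_nth)
      then have "j \<le> i" using last z bk by (auto simp: node_content_def)
      moreover have "i \<le> j" using node_step_index_less[OF s i(1) si j] by simp
      ultimately show False using j si by auto
    qed
    ultimately have "node_step m s (k, Suc r, Suc c)"
      using bk by (simp add: node_step_def)
    then show ?thesis
      using bk z by (intro exI[of _ "(k, Suc r, Suc c)"]) (auto simp: node_content_def)
  next
    case False
    then have fresh: "node_content x \<noteq> b" if "x \<in> set s" for x
      using that by (auto simp: in_set_conv_nth)
    \<comment> \<open>The first node of diagonal \<open>z\<close> lies in row 0 or column 0; its
      only possible predecessor follows by down-closure from any node on an adjacent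
      diagonal.\<close>
    let ?x = "(k, nat (- z), nat z)"
    have content: "node_content ?x = b" using bk by (auto simp: node_content_def)
    have near: "\<exists>r c. (k, r, c) \<in> set s \<and> (int c - int r = z - 1 \<or> int c - int r = z + 1)" if "z \<noteq> 0"
      using b that bk by (fastforce simp: diag_step_def node_content_def)
    have "(k, nat (- z), nat z - 1) \<in> set s" if "0 < z"
      using that near node_step_down_closed[OF s] by fastforce
    moreover have "(k, nat (- z) - 1, nat z) \<in> set s" if "z < 0"
      using that near node_step_down_closed[OF s] by fastforce
    ultimately have "node_step m s ?x"
      using fresh[of ?x] content bk unfolding node_step_def by auto
    then show ?thesis using content by blast
  qed
qed

lemma bij_betw_node_content:
  "bij_betw (map node_content) {s. stepwise (node_step m) s \<and> length s = n}
     {s. stepwise (diag_step m) s \<and> length s = n}"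
proof (intro bij_betw_stepwise bij_betw_imageI inj_on_node_content)
  fix s assume "stepwise (node_step m) s"
  then show "node_content ` {x. node_step m s x} = {y. diag_step m (map node_content s) y}"
    using diag_step_node_content addable_node_ex by blast
qed

section \<open>Values of contents\<close>

lemma set_drop_take:
  assumes "j \<le> length a"
  shows "set (drop (Suc i) (take j a)) = (!) a ` {i<..<j}"
proof -
  have "set (drop (Suc i) (take j a)) = {take j a ! l | l. Suc i \<le> l \<and> l < j}"
    using assms by (simp add: set_drop_conv_nth)
  also have "\<dots> = (!) a ` {i<..<j}"
    by (force simp: image_iff Suc_le_eq)
  finally show ?thesis .
qed

text \<open>The neighbours of an entry are its quotient and product with \<open>q^2\<close>,
  whichever expression \<open>v k * q powi (2 * z)\<close> is chosen for it. This removes the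
  possibly ambiguous exponents from (c2) and (c3).\<close>

definition value_step :: "'a::field set \<Rightarrow> 'a \<Rightarrow> (nat \<Rightarrow> 'a) \<Rightarrow> nat \<Rightarrow> 'a list \<Rightarrow> 'a \<Rightarrow> bool" where
  "value_step K q v m s b \<longleftrightarrow>
     b \<in> K \<and> (\<exists>k\<in>{1..m}. \<exists>z::int. b = v k * q powi (2 * z)) \<and>
     (b \<in> v ` {1..m} \<or> b / q\<^sup>2 \<in> set s \<or> b * q\<^sup>2 \<in> set s) \<and>
     (\<forall>i<length s. s ! i = b \<longrightarrow>
        b / q\<^sup>2 \<in> set (drop (Suc i) s) \<and> b * q\<^sup>2 \<in> set (drop (Suc i) s))"

lemma powi_shift:
  fixes q :: "'a::field"
  assumes "q \<noteq> 0"
  shows "x * q powi (2 * (z - 1)) = x * q powi (2 * z) / q\<^sup>2"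
    and "x * q powi (2 * (z + 1)) = x * q powi (2 * z) * q\<^sup>2"
proof -
  have "q powi (2 * (z - 1)) = q powi (2 * z) / q\<^sup>2"
    using assms power_int_diff[of q "2 * z" 2] by (simp add: algebra_simps)
  then show "x * q powi (2 * (z - 1)) = x * q powi (2 * z) / q\<^sup>2" by simp
  have "q powi (2 * (z + 1)) = q powi (2 * z) * q\<^sup>2"
    using assms power_int_add[of q "2 * z" 2] by (simp add: algebra_simps)
  then show "x * q powi (2 * (z + 1)) = x * q powi (2 * z) * q\<^sup>2" by simp
qed

lemma content_string_iff_stepwise:
  assumes q: "q \<noteq> 0"
  shows "content_string K q v m a \<longleftrightarrow> stepwise (value_step K q v m) a"
proof
  assume c: "content_string K q v m a"
  note c = c[unfolded content_string_def]
  note in_K = c[THEN conjunct1, THEN subsetD]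
    and rep = c[THEN conjunct2, THEN conjunct1, THEN bspec]
    and first = c[THEN conjunct2, THEN conjunct2, THEN conjunct1, THEN mp]
    and neighbour = c[THEN conjunct2, THEN conjunct2, THEN conjunct2, THEN conjunct1, rule_format]
    and between = c[THEN conjunct2, THEN conjunct2, THEN conjunct2, THEN conjunct2, rule_format]
  show "stepwise (value_step K q v m) a"
    unfolding stepwise_def
  proof (intro allI impI)
    fix j assume j: "j < length a"
    have mem: "a ! j \<in> set a" using j by simp
    then obtain k z where k: "k \<in> {1..m}" and aj: "a ! j = v k * q powi (2 * z)"
      using rep by blast
    have neighbours: "v k * q powi (2 * (z - 1)) = a ! j / q\<^sup>2" "v k * q powi (2 * (z + 1)) = a ! j * q\<^sup>2"
      unfolding aj powi_shift[OF q] by (rule refl)+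
    have "a ! j \<in> v ` {1..m} \<or> a ! j / q\<^sup>2 \<in> set (take j a) \<or> a ! j * q\<^sup>2 \<in> set (take j a)"
    proof (cases "a ! j \<in> v ` {1..m} \<or> j = 0")
      case True
      moreover have "a \<noteq> []" using j by auto
      ultimately show ?thesis using first by auto
    next
      case False
      \<comment> \<open>An entry that differs from all parameters \<open>v k\<close> has a nonzero
        exponent in every representation.\<close>
      then have "z \<noteq> 0" using aj k by auto
      then have "{v k * q powi (2 * (z - 1)), v k * q powi (2 * (z + 1))} \<inter> (!) a ` {0..<j} \<noteq> {}"
        using neighbour[OF _ j k _ aj] False by blast
      then show ?thesis
        unfolding neighbours nth_image[OF less_imp_le[OF j]] by auto
    qed
    moreover have "a ! j / q\<^sup>2 \<in> set (drop (Suc i) (take j a)) \<and> a ! j * q\<^sup>2 \<in> set (drop (Suc i) (take j a))"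
      if "i < length (take j a)" "take j a ! i = a ! j" for i
    proof -
      have "{v k * q powi (2 * (z - 1)), v k * q powi (2 * (z + 1))} \<subseteq> (!) a ` {i<..<j}"
        using between[OF _ j k _ aj, of i] that by simp
      then show ?thesis
        unfolding neighbours set_drop_take[OF less_imp_le[OF j]] by simp
    qed
    ultimately show "value_step K q v m (take j a) (a ! j)"
      using in_K[OF mem] rep[OF mem] unfolding value_step_def by (intro conjI) simp_all
  qed
next
  assume s: "stepwise (value_step K q v m) a"
  have step: "value_step K q v m (take j a) (a ! j)" if "j < length a" for j
    using stepwise_nth[OF s that] .
  show "content_string K q v m a"
    unfolding content_string_def
  proof (intro conjI allI impI ballI subsetI)
    fix x assume "x \<in> set a"
    then obtain j where j: "j < length a" "x = a ! j"
      by (auto simp: in_set_conv_nth)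
    then show "x \<in> K" "\<exists>k\<in>{1..m}. \<exists>z::int. x = v k * q powi (2 * z)"
      using step[of j] by (auto simp: value_step_def)
  next
    assume "a \<noteq> []"
    then show "a ! 0 \<in> v ` {1..m}" using step[of 0] by (simp add: value_step_def)
  next
    fix j k and z :: int
    assume j: "j < length a" and "a ! j = v k * q powi (2 * z)" "a ! j \<notin> v ` {1..m}"
    then show "{v k * q powi (2 * (z - 1)), v k * q powi (2 * (z + 1))} \<inter> (!) a ` {0..<j} \<noteq> {}"
      using step[OF j] unfolding powi_shift[OF q] nth_image[OF less_imp_le[OF j]]
      by (auto simp: value_step_def)
  next
    fix i j k and z :: int and x
    assume ij: "i < j" "j < length a" "a ! i = a ! j" and aj: "a ! j = v k * q powi (2 * z)"
      and x: "x \<in> {v k * q powi (2 * (z - 1)), v k * q powi (2 * (z + 1))}"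
    have "x = a ! j / q\<^sup>2 \<or> x = a ! j * q\<^sup>2"
      using x unfolding powi_shift[OF q] aj by auto
    moreover have "a ! j / q\<^sup>2 \<in> set (drop (Suc i) (take j a)) \<and> a ! j * q\<^sup>2 \<in> set (drop (Suc i) (take j a))"
      using step[OF ij(2)] ij unfolding value_step_def by auto
    ultimately have "x \<in> set (drop (Suc i) (take j a))" by auto
    then show "x \<in> (!) a ` {i<..<j}"
      using set_drop_take[OF less_imp_le[OF ij(2)]] by simp
  qed
qed

section \<open>Sets of contents closed under steps towards 0\<close>

definition closed_contents :: "(nat \<times> int) set \<Rightarrow> bool" where
  "closed_contents S \<longleftrightarrow> (\<forall>k z. (k, z) \<in> S \<longrightarrow> z \<noteq> 0 \<longrightarrow> (k, z - sgn z) \<in> S)"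

lemma closed_contents_between:
  assumes S: "closed_contents S" and "(k, z) \<in> S" "min 0 z \<le> y" "y \<le> max 0 z"
  shows "(k, y) \<in> S"
  using assms(2-)
proof (induction "nat \<bar>z\<bar>" arbitrary: z)
  case 0
  then show ?case by simp
next
  case (Suc d)
  then have "z \<noteq> 0" by auto
  then have *: "(k, z - sgn z) \<in> S" using S Suc.prems by (auto simp: closed_contents_def)
  show ?case
  proof (cases "y = z")
    case False
    then show ?thesis
      using Suc.prems Suc.hyps(2) by (intro Suc.hyps(1)[OF _ *]) (auto simp: sgn_if split: if_splits)
  qed (use Suc in simp)
qed

text \<open>The whole interval from \<open>z\<close> to \<open>z'\<close> belongs to the set, since
  each of its points lies between 0 and one of the two ends.\<close>

lemma closed_contents_diff_less_card:
  assumes S: "closed_contents S" "finite S" and "(k, z) \<in> S" "(k, z') \<in> S"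
  shows "\<bar>z - z'\<bar> < int (card S)"
proof -
  have "Pair k ` {min z z'..max z z'} \<subseteq> S"
  proof clarify
    fix y assume "y \<in> {min z z'..max z z'}"
    then have "min 0 z \<le> y \<and> y \<le> max 0 z \<or> min 0 z' \<le> y \<and> y \<le> max 0 z'" by auto
    then show "(k, y) \<in> S" using closed_contents_between[OF S(1)] assms(3,4) by blast
  qed
  from card_mono[OF S(2) this] show ?thesis
    by (simp add: card_image inj_on_def)
qed

text \<open>The intervals from 0 to \<open>z\<close> and from 0 to \<open>z'\<close> belong to
  different indices, so their sizes add up; each contributes its own 0, hence the 2.\<close>

lemma closed_contents_sum_less_card:
  assumes S: "closed_contents S" "finite S" and "(k, z) \<in> S" "(k', z') \<in> S" "k \<noteq> k'"
  shows "\<bar>z\<bar> + \<bar>z'\<bar> + 2 \<le> int (card S)"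
proof -
  have "Pair k ` {min 0 z..max 0 z} \<union> Pair k' ` {min 0 z'..max 0 z'} \<subseteq> S"
    using closed_contents_between[OF S(1)] assms(3,4) by auto
  then have "card (Pair k ` {min 0 z..max 0 z} \<union> Pair k' ` {min 0 z'..max 0 z'}) \<le> card S"
    using card_mono[OF S(2)] by blast
  moreover have "card (Pair k ` {min 0 z..max 0 z} \<union> Pair k' ` {min 0 z'..max 0 z'}) =
    nat (\<bar>z\<bar> + 1) + nat (\<bar>z'\<bar> + 1)"
    using assms(5) by (subst card_Un_disjoint) (auto simp: card_image inj_on_def min_def max_def)
  ultimately show ?thesis by linarith
qed

text \<open>For nonzero \<open>z\<close>, the number \<open>z - sgn z\<close> lies between 0 and
  \<open>y\<close>, whether \<open>y\<close> is the inner or the outer neighbour of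
  \<open>z\<close>.\<close>

lemma closed_contents_insert_neighbour:
  assumes S: "closed_contents S" and y: "(k, y) \<in> S" "\<bar>z - y\<bar> = 1"
  shows "closed_contents (insert (k, z) S)"
proof -
  have "(k, z - sgn z) \<in> S" if "z \<noteq> 0"
    using that y(2) by (intro closed_contents_between[OF S y(1)]) (auto simp: sgn_if)
  then show ?thesis using S by (auto simp: closed_contents_def)
qed

lemma closed_contents_insert_zero:
  "closed_contents S \<Longrightarrow> closed_contents (insert (k, 0) S)"
  by (auto simp: closed_contents_def)

lemma closed_contents_insert_diag_step:
  assumes "closed_contents (set s)" "diag_step m s x"
  shows "closed_contents (insert x (set s))"
proof (cases "snd x = 0")
  case True
  then show ?thesis using closed_contents_insert_zero[OF assms(1)] by (cases x) auto
next
  case False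
  then obtain y where "(fst x, y) \<in> set s" "\<bar>snd x - y\<bar> = 1"
    using assms(2) by (auto simp: diag_step_def)
  then show ?thesis
    using closed_contents_insert_neighbour[OF assms(1)] by (metis prod.collapse)
qed

lemma closed_contents_stepwise: "stepwise (diag_step m) s \<Longrightarrow> closed_contents (set s)"
proof (induction s rule: rev_induct)
  case Nil
  then show ?case by (simp add: closed_contents_def)
next
  case (snoc x s)
  then show ?case using closed_contents_insert_diag_step[of s m x] by simp
qed

lemma diag_step_index: "stepwise (diag_step m) s \<Longrightarrow> x \<in> set s \<Longrightarrow> fst x \<in> {1..m}"
  by (auto simp: stepwise_def diag_step_def in_set_conv_nth)

text \<open>These are the consequences shared by both kinds of parameters. Nonnegative exponents
  suffice, because two contents can be compared starting from the one with the larger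
  exponent.\<close>

locale generic_parameters =
  fixes K :: "'a::field set" and q :: 'a and v :: "nat \<Rightarrow> 'a" and m n :: nat
  assumes q_nonzero: "q \<noteq> 0"
    and v_nonzero: "k \<in> {1..m} \<Longrightarrow> v k \<noteq> 0"
    and v_separated: "j \<in> {1..m} \<Longrightarrow> k \<in> {1..m} \<Longrightarrow> j \<noteq> k \<Longrightarrow> i < n \<Longrightarrow> v j * q ^ (2 * i) \<noteq> v k"
    and q_order: "0 < i \<Longrightarrow> i \<le> n \<Longrightarrow> q ^ (2 * i) \<noteq> 1"
    and values_in: "k \<in> {1..m} \<Longrightarrow> v k * q powi (2 * z) \<in> K"
begin

definition content_value :: "nat \<times> int \<Rightarrow> 'a" where
  "content_value = (\<lambda>(k, z). v k * q powi (2 * z))"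

lemma content_value_shift:
  "content_value (k, z - 1) = content_value (k, z) / q\<^sup>2"
  "content_value (k, z + 1) = content_value (k, z) * q\<^sup>2"
  unfolding content_value_def using powi_shift[OF q_nonzero] by auto

lemma content_value_eq_imp:
  assumes "content_value (k, z) = content_value (k', z')" "z' \<le> z"
  shows "v k * q ^ (2 * nat (z - z')) = v k'"
proof -
  have "q powi (2 * z) = q powi (2 * (z - z')) * q powi (2 * z')"
    using q_nonzero by (simp flip: power_int_add)
  moreover have "q powi (2 * (z - z')) = q ^ (2 * nat (z - z'))"
    using assms(2) nat_mult_distrib[of 2 "z - z'"] by (simp add: power_int_def)
  ultimately show ?thesis
    using assms(1) q_nonzero by (simp add: content_value_def)
qed

text \<open>At most \<open>n\<close> entries and one neighbour of an entry are compared at a time, hence the bound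
  \<open>Suc n\<close>; the assumptions on the parameters are just strong enough for it.\<close>

lemma inj_on_content_value:
  assumes S: "closed_contents S" "finite S" "card S \<le> Suc n" "fst ` S \<subseteq> {1..m}"
  shows "inj_on content_value S"
proof -
  have wlog: "k = k' \<and> z = z'"
    if *: "(k, z) \<in> S" "(k', z') \<in> S" "content_value (k, z) = content_value (k', z')" "z' \<le> z"
    for k z k' z'
  proof -
    have eq: "v k * q ^ (2 * nat (z - z')) = v k'"
      using content_value_eq_imp * by blast
    have k: "k \<in> {1..m}" "k' \<in> {1..m}" using S(4) * by force+
    show ?thesis
    proof (cases "k = k'")
      case True
      then have "q ^ (2 * nat (z - z')) = 1" using eq v_nonzero k by simp
      \<comment> \<open>Within one diagram the distance is less than \<open>card S\<close>, so at
        most \<open>n\<close>, the bound in \<open>q_order\<close>.\<close>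
      moreover have "nat (z - z') \<le> n"
        using closed_contents_diff_less_card[OF S(1,2), of k z z'] * True S(3) by auto
      ultimately have "nat (z - z') = 0" using q_order by blast
      then show ?thesis using True * by auto
    next
      case False
      \<comment> \<open>Two diagrams use up two zeros, which leaves a distance of at most
        \<open>n - 1\<close>, as \<open>v_separated\<close> requires.\<close>
      have "nat (z - z') < n"
        using closed_contents_sum_less_card[OF S(1,2) *(1,2) False] S(3) by linarith
      then show ?thesis using v_separated[OF k False] eq by blast
    qed
  qed
  show ?thesis
  proof (rule inj_onI, clarify)
    fix k z k' z'
    assume "(k, z) \<in> S" "(k', z') \<in> S" "content_value (k, z) = content_value (k', z')"
    then show "k = k' \<and> z = z'" using wlog[of k z k' z'] wlog[of k' z' k z] by (cases "z' \<le> z") auto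
  qed
qed

context
  fixes s assumes s: "stepwise (diag_step m) s" and short: "length s < n"
begin

text \<open>Two extra contents leave room to compare two candidates for the next entry.\<close>

lemma card_insert2: "card (insert x (insert y (set s))) \<le> Suc n"
  using card_length[of "x # y # s"] short by simp

text \<open>Neighbouring contents have neighbouring values. For (c3), injectivity on the prefix
  together with \<open>x\<close> shows that an earlier entry of equal value has equal
  content.\<close>

lemma value_step_content_value:
  assumes x: "diag_step m s x"
  shows "value_step K q v m (map content_value s) (content_value x)"
proof -
  obtain k z where [simp]: "x = (k, z)" by (cases x)
  have k: "k \<in> {1..m}" using x by (simp add: diag_step_def)
  have "content_value x \<in> v ` {1..m} \<or> content_value x / q\<^sup>2 \<in> content_value ` set s \<or>
      content_value x * q\<^sup>2 \<in> content_value ` set s"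
  proof (cases "z = 0")
    case True
    then show ?thesis using k by (simp add: content_value_def)
  next
    case False
    then show ?thesis using x by (auto simp: diag_step_def simp flip: content_value_shift)
  qed
  moreover have "content_value x / q\<^sup>2 \<in> set (drop (Suc i) (map content_value s)) \<and>
      content_value x * q\<^sup>2 \<in> set (drop (Suc i) (map content_value s))"
    if i: "i < length s" "content_value (s ! i) = content_value x" for i
  proof -
    have "inj_on content_value (insert x (set s))"
    proof (rule inj_on_content_value)
      show "closed_contents (insert x (set s))"
        using closed_contents_insert_diag_step[OF closed_contents_stepwise[OF s] x] .
      show "card (insert x (set s)) \<le> Suc n" using card_insert2[of x x] by simp
      show "fst ` insert x (set s) \<subseteq> {1..m}" using diag_step_index[OF s] k by auto
    qed simp
    then have "s ! i = x" using i by (meson inj_onD insertI1 insertI2 nth_mem)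
    then show ?thesis
      using x i by (auto simp: diag_step_def drop_map simp flip: content_value_shift)
  qed
  moreover have "content_value x \<in> K" "\<exists>k\<in>{1..m}. \<exists>z. content_value x = v k * q powi (2 * z)"
    using k values_in by (auto simp: content_value_def)
  ultimately show ?thesis by (simp add: value_step_def)
qed

lemma inj_on_content_value_step: "inj_on content_value {x. diag_step m s x}"
proof (rule inj_onI, unfold mem_Collect_eq)
  fix x y assume x: "diag_step m s x" and y: "diag_step m s y" and eq: "content_value x = content_value y"
  have "inj_on content_value (insert x (insert y (set s)))"
  proof (rule inj_on_content_value)
    have "closed_contents (insert x (set s))" "closed_contents (insert y (set s))"
      using closed_contents_insert_diag_step[OF closed_contents_stepwise[OF s]] x y by auto
    \<comment> \<open>A union of two closed sets is closed.\<close>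
    then show "closed_contents (insert x (insert y (set s)))"
      unfolding closed_contents_def by blast
    show "fst ` insert x (insert y (set s)) \<subseteq> {1..m}"
      using diag_step_index[OF s] x y by (auto simp: diag_step_def)
  qed (simp_all add: card_insert2)
  then show "x = y" using eq by (meson inj_onD insertI1 insertI2)
qed

text \<open>A value \<open>v k\<close> is lifted to exponent 0, any other value to a neighbour of a
  content in \<open>s\<close>. For (c3), values found between the occurrences are lifted back to
  contents by injectivity.\<close>

lemma diag_step_ex:
  assumes b: "value_step K q v m (map content_value s) b"
  shows "\<exists>x. diag_step m s x \<and> content_value x = b"
proof -
  note closed = closed_contents_stepwise[OF s]
  have "\<exists>k z. k \<in> {1..m} \<and> content_value (k, z) = b \<and>
      (z = 0 \<or> (k, z - 1) \<in> set s \<or> (k, z + 1) \<in> set s)"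
  proof (cases "b \<in> v ` {1..m}")
    case True
    then obtain k where "k \<in> {1..m}" "b = v k" by auto
    then show ?thesis by (intro exI[of _ k] exI[of _ 0]) (simp add: content_value_def)
  next
    case False
    then consider "b / q\<^sup>2 \<in> content_value ` set s" | "b * q\<^sup>2 \<in> content_value ` set s"
      using b by (auto simp: value_step_def)
    then show ?thesis
    proof cases
      case 1
      then obtain k z where "(k, z) \<in> set s" "content_value (k, z) = b / q\<^sup>2" by auto
      then show ?thesis
        using diag_step_index[OF s] q_nonzero
        by (intro exI[of _ k] exI[of _ "z + 1"]) (force simp: content_value_shift)
    next
      case 2
      then obtain k z where "(k, z) \<in> set s" "content_value (k, z) = b * q\<^sup>2" by auto
      then show ?thesis
        using diag_step_index[OF s] q_nonzero
        by (intro exI[of _ k] exI[of _ "z - 1"]) (force simp: content_value_shift)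
    qed
  qed
  then obtain k z where k: "k \<in> {1..m}" and bk: "content_value (k, z) = b"
    and near: "z = 0 \<or> (k, z - 1) \<in> set s \<or> (k, z + 1) \<in> set s" by blast
  have "closed_contents (insert (k, z) (set s))"
    using near closed_contents_insert_zero[OF closed] closed_contents_insert_neighbour[OF closed, of k _ z]
    by fastforce
  note closed' = this
  have "(k, z + d) \<in> set (drop (Suc i) s)"
    if i: "i < length s" "s ! i = (k, z)" and d: "\<bar>d\<bar> = 1"
      and mem: "content_value (k, z + d) \<in> set (drop (Suc i) (map content_value s))" for i d
  proof -
    obtain w where w: "w \<in> set (drop (Suc i) s)" "content_value w = content_value (k, z + d)"
      using mem by (auto simp: drop_map)
    have "w \<in> set s" using w(1) in_set_dropD by fast
    \<comment> \<open>Since \<open>(k, z)\<close> occurs in \<open>s\<close>, adding its neighbour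
      keeps the set closed, and the witness \<open>w\<close> can be identified with that
      neighbour.\<close>
    have "inj_on content_value (insert (k, z + d) (set s))"
    proof (rule inj_on_content_value)
      show "closed_contents (insert (k, z + d) (set s))"
        using d i by (intro closed_contents_insert_neighbour[OF closed, of k z]) (auto, metis nth_mem)
      show "card (insert (k, z + d) (set s)) \<le> Suc n"
        using card_insert2[of "(k, z + d)" "(k, z + d)"] by simp
      show "fst ` insert (k, z + d) (set s) \<subseteq> {1..m}"
        using diag_step_index[OF s] k by auto
    qed simp
    then have "w = (k, z + d)" using w(2) \<open>w \<in> set s\<close> by (meson inj_onD insertI1 insertI2)
    then show ?thesis using w(1) by simp
  qed
  note drop = this
  have "diag_step m s (k, z)"
    unfolding diag_step_def prod.case
  proof (intro conjI allI impI)
    fix i assume i: "i < length s" "s ! i = (k, z)"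
    then have *: "b / q\<^sup>2 \<in> set (drop (Suc i) (map content_value s))"
      "b * q\<^sup>2 \<in> set (drop (Suc i) (map content_value s))"
      using b bk by (auto simp: value_step_def)
    show "(k, z - 1) \<in> set (drop (Suc i) s)"
      using drop[OF i, of "-1"] * content_value_shift[of k z] bk by simp
    show "(k, z + 1) \<in> set (drop (Suc i) s)"
      using drop[OF i, of 1] * content_value_shift[of k z] bk by simp
  qed (use k near in auto)
  then show ?thesis using bk by blast
qed

end

lemma bij_betw_content_value:
  "bij_betw (map content_value) {s. stepwise (diag_step m) s \<and> length s = n} (Cont K q v m n)"
proof -
  have "bij_betw (map content_value) {s. stepwise (diag_step m) s \<and> length s = n}
      {s. stepwise (value_step K q v m) s \<and> length s = n}"
  proof (intro bij_betw_stepwise bij_betw_imageI)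
    fix s assume s: "stepwise (diag_step m) s" "length s < n"
    show "inj_on content_value {x. diag_step m s x}"
      using inj_on_content_value_step[OF s] .
    show "content_value ` {x. diag_step m s x} = {y. value_step K q v m (map content_value s) y}"
      using value_step_content_value[OF s] diag_step_ex[OF s] by blast
  qed
  then show ?thesis
    by (simp add: Cont_def content_string_iff_stepwise[OF q_nonzero] conj_commute)
qed

end

text \<open>For \<open>n = 1\<close> the parameters may satisfy \<open>q\<^sup>2 = 1\<close>, where values do not determine contents.\<close>

lemma bij_betw_content_value_one:
  assumes q: "q \<noteq> 0" and inj: "inj_on v {1..m}" and K: "v ` {1..m} \<subseteq> K"
  shows "bij_betw (map (\<lambda>(k, z). v k)) {s. stepwise (diag_step m) s \<and> length s = 1} (Cont K q v m 1)"
proof -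
  have "bij_betw (map (\<lambda>(k, z). v k)) {s. stepwise (diag_step m) s \<and> length s = 1}
      {s. stepwise (value_step K q v m) s \<and> length s = 1}"
  proof (intro bij_betw_stepwise bij_betw_imageI)
    fix s :: "(nat \<times> int) list" assume "length s < 1"
    then have [simp]: "s = []" by simp
    have *: "{x. diag_step m s x} = (\<lambda>k. (k, 0)) ` {1..m}"
      by (auto simp: diag_step_def)
    show "inj_on (\<lambda>(k, z). v k) {x. diag_step m s x}"
      unfolding * by (rule inj_onI) (use inj in \<open>auto dest: inj_onD\<close>)
    have "\<exists>k'\<in>{1..m}. \<exists>z::int. v k = v k' * q powi (2 * z)" if "k \<in> {1..m}" for k
      using that by (intro bexI[of _ k] exI[of _ 0]) auto
    then show "(\<lambda>(k, z). v k) ` {x. diag_step m s x} = {y. value_step K q v m (map (\<lambda>(k, z). v k) s) y}"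
      unfolding * using K by (auto simp: value_step_def image_image)
  qed
  then show ?thesis
    by (simp add: Cont_def content_string_iff_stepwise[OF q] conj_commute)
qed

section \<open>The two kinds of parameters\<close>

lemma indet_power: "indet i ^ e = Fract (Poly_Mapping.single (Poly_Mapping.single i e) 1) 1"
proof (induction e)
  case 0
  then show ?case by (simp add: One_fract_def single_one)
next
  case (Suc e)
  then show ?case
    by (simp add: indet_def mult_single flip: single_add)
qed

text \<open>The key set of a monomial with coefficient 1 recovers its exponents, so identities
  between products of indeterminates become identities of exponents.\<close>

lemma Fract_monomial_eq_iff:
  "Fract (Poly_Mapping.single \<mu> 1 :: cpoly) 1 = Fract (Poly_Mapping.single \<nu> 1) 1 \<longleftrightarrow> \<mu> = \<nu>"
proof
  assume "Fract (Poly_Mapping.single \<mu> 1 :: cpoly) 1 = Fract (Poly_Mapping.single \<nu> 1) 1"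
  then have "(Poly_Mapping.single \<mu> 1 :: cpoly) = Poly_Mapping.single \<nu> 1"
    by (simp add: eq_fract)
  then have "Poly_Mapping.keys (Poly_Mapping.single \<mu> 1 :: cpoly) = Poly_Mapping.keys (Poly_Mapping.single \<nu> 1 :: cpoly)"
    by simp
  then show "\<mu> = \<nu>" by simp
qed simp

lemma indet_nonzero: "indet i \<noteq> 0"
proof
  assume "indet i = 0"
  then have "(Poly_Mapping.single (Poly_Mapping.single i 1) 1 :: cpoly) = 0"
    unfolding indet_def Zero_fract_def by (subst (asm) eq_fract) auto
  then have "Poly_Mapping.keys (Poly_Mapping.single (Poly_Mapping.single i 1) 1 :: cpoly) = {}"
    by simp
  then show False by simp
qed

lemma indet_power_neq_one:
  assumes "0 < e"
  shows "indet i ^ e \<noteq> 1"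
proof
  assume "indet i ^ e = 1"
  then have "indet i ^ e = indet i ^ 0" by simp
  then have "Poly_Mapping.single i e = Poly_Mapping.single i 0"
    unfolding indet_power Fract_monomial_eq_iff .
  then have "Poly_Mapping.lookup (Poly_Mapping.single i e) i = 0" by simp
  then show False using assms by simp
qed

lemma indet_mult_power:
  "indet j * indet i ^ e = Fract (Poly_Mapping.single (Poly_Mapping.single j 1 + Poly_Mapping.single i e) 1) 1"
  unfolding indet_power by (simp add: indet_def mult_single)

lemma indet_mult_power_neq:
  assumes "j \<noteq> k"
  shows "indet j * indet i ^ e \<noteq> indet k"
proof
  assume "indet j * indet i ^ e = indet k"
  then have "Poly_Mapping.single j 1 + Poly_Mapping.single i e = Poly_Mapping.single k (1::nat)"
    unfolding indet_mult_power unfolding indet_def Fract_monomial_eq_iff .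
  \<comment> \<open>The exponent of the indeterminate \<open>j\<close> is positive on the left and 0
    on the right.\<close>
  then have "Poly_Mapping.lookup (Poly_Mapping.single j 1 + Poly_Mapping.single i e) j = Poly_Mapping.lookup (Poly_Mapping.single k (1::nat)) j"
    by simp
  then show False using assms by (simp add: lookup_add lookup_single)
qed

lemma monomial_in_polys_in:
  "Poly_Mapping.keys \<mu> \<subseteq> {0..m} \<Longrightarrow> Poly_Mapping.single \<mu> c \<in> polys_in m"
  by (auto simp: polys_in_def)

lemma indet_mult_powi_in_ratfuns:
  assumes "k \<le> m" "i \<le> m"
  shows "indet k * indet i powi z \<in> ratfuns m"
proof -
  have keys: "Poly_Mapping.keys (Poly_Mapping.single j e) \<subseteq> {0..m}" if "j \<le> m" for j and e :: nat
    using that by auto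
  have one: "1 \<in> polys_in m"
    using monomial_in_polys_in[of 0 m 1] by (simp add: single_one)
  show ?thesis
  proof (cases "0 \<le> z")
    case True
    have "Poly_Mapping.keys (Poly_Mapping.single k 1 + Poly_Mapping.single i (nat z)) \<subseteq> {0..m}"
      using keys_add[of "Poly_Mapping.single k 1" "Poly_Mapping.single i (nat z)"]
        keys[OF assms(1), of 1] keys[OF assms(2), of "nat z"] by blast
    moreover have "indet k * indet i powi z = indet k * indet i ^ nat z"
      using True by (simp add: power_int_def)
    ultimately show ?thesis
      unfolding ratfuns_def indet_mult_power using monomial_in_polys_in one by fastforce
  next
    case False
    \<comment> \<open>A negative power of the indeterminate \<open>i\<close> becomes the
      denominator.\<close>
    let ?g = "Poly_Mapping.single (Poly_Mapping.single i (nat (- z))) 1 :: cpoly"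
    have g: "?g \<noteq> 0"
    proof
      assume "?g = 0"
      then have "Poly_Mapping.keys ?g = {}" by (simp only: keys_zero)
      then show False by simp
    qed
    have "indet k * indet i powi z = indet k * inverse (indet i ^ nat (- z))"
      using False by (simp add: power_int_def power_inverse)
    also have "\<dots> = Fract (Poly_Mapping.single (Poly_Mapping.single k 1) 1) ?g"
      unfolding indet_power by (simp add: indet_def)
    finally show ?thesis
      unfolding ratfuns_def using monomial_in_polys_in keys assms g by blast
  qed
qed

lemma generic_parameters_indet: "generic_parameters (ratfuns m) (indet 0) indet m n"
proof
  fix k z assume "k \<in> {1..m}"
  then show "indet k * indet 0 powi (2 * z) \<in> ratfuns m"
    by (intro indet_mult_powi_in_ratfuns) auto
qed (auto simp: indet_nonzero indet_mult_power_neq indet_power_neq_one)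

section \<open>Complex parameters\<close>

lemma generic_parameters_complex:
  assumes p: "complex_parameters m n q v" and q2: "q\<^sup>2 \<noteq> 1"
  shows "generic_parameters UNIV q v m n"
proof
  show "q \<noteq> 0" and "\<And>k. k \<in> {1..m} \<Longrightarrow> v k \<noteq> 0"
    using p by (auto simp: complex_parameters_def)
next
  fix j k i assume jk: "j \<in> {1..m}" "k \<in> {1..m}" "j \<noteq> k" and i: "i < n"
  then have "q powi (2 * int i) * v j - v k \<noteq> 0"
    using p unfolding complex_parameters_def by auto
  moreover have "q powi (2 * int i) = q ^ (2 * i)"
    using power_int_of_nat[of q "2 * i"] by simp
  ultimately show "v j * q ^ (2 * i) \<noteq> v k" by (simp add: mult.commute)
next
  fix i assume i: "0 < i" "i \<le> n"
  \<comment> \<open>The hypothesis is used with \<open>N = i - 1\<close>. As \<open>q^2\<close> is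
    not 1, the geometric sum turns its nonvanishing into \<open>q ^ (2 * i)\<close> being different
    from 1.\<close>
  then have "(\<Sum>l=0..i - 1. q ^ (2 * l)) \<noteq> 0"
    using p unfolding complex_parameters_def by auto
  moreover have "(\<Sum>l=0..i - 1. q ^ (2 * l)) = (\<Sum>l<i. (q\<^sup>2) ^ l)"
    using i by (intro sum.cong) (auto simp: power_mult)
  ultimately show "q ^ (2 * i) \<noteq> 1"
    using geometric_sum[OF q2, of i] q2 by (auto simp: power_mult)
qed auto

lemma complex_parameters_inj_on:
  assumes "complex_parameters m n q v" "n \<ge> 1"
  shows "inj_on v {1..m}"
proof (rule inj_onI, rule ccontr)
  fix j k assume "j \<in> {1..m}" "k \<in> {1..m}" "v j = v k" "j \<noteq> k"
  \<comment> \<open>Exponent 0 is within the allowed range because \<open>n\<close> is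
    positive.\<close>
  moreover have "q powi (2 * 0) * v j - v k \<noteq> 0"
    using assms calculation unfolding complex_parameters_def by (metis neg_less_0_iff_less of_nat_0_less_iff less_le_trans zero_less_one)
  ultimately show False by simp
qed

section \<open>The bijection\<close>

lemma bij_betw_std_tableaux:
  assumes "bij_betw f {s. stepwise (diag_step m) s \<and> length s = n} A"
  shows "\<exists>g. bij_betw g (std_tableaux m n) A"
  using bij_betw_trans[OF bij_betw_node_list bij_betw_trans[OF bij_betw_node_content assms]] by blast

theorem proposition5:
  fixes m n :: nat
  assumes "m \<ge> 1" and "n \<ge> 1"
  shows "(\<exists>f. bij_betw f (std_tableaux m n) (Cont (ratfuns m) (indet 0) indet m n)) \<and>
    (\<forall>(q :: complex) v. complex_parameters m n q v \<longrightarrow> (n \<ge> 2 \<longrightarrow> q\<^sup>2 \<noteq> 1) \<longrightarrow>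
       (\<exists>f. bij_betw f (std_tableaux m n) (Cont UNIV q v m n)))"
proof (intro conjI allI impI)
  show "\<exists>f. bij_betw f (std_tableaux m n) (Cont (ratfuns m) (indet 0) indet m n)"
    by (rule bij_betw_std_tableaux)
      (rule generic_parameters.bij_betw_content_value[OF generic_parameters_indet])
next
  fix q :: complex and v
  assume p: "complex_parameters m n q v" and q: "n \<ge> 2 \<longrightarrow> q\<^sup>2 \<noteq> 1"
  show "\<exists>f. bij_betw f (std_tableaux m n) (Cont UNIV q v m n)"
  \<comment> \<open>Only for \<open>n = 1\<close> may \<open>q^2\<close> be 1; there every exponent
    is 0, so reading off the diagram index is enough.\<close>
  proof (cases "n = 1")
    case True
    have "q \<noteq> 0" using p by (simp add: complex_parameters_def)
    from bij_betw_content_value_one[OF this complex_parameters_inj_on[OF p assms(2)], of UNIV]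
    show ?thesis unfolding True by (intro bij_betw_std_tableaux) simp_all
  next
    case False
    then have "q\<^sup>2 \<noteq> 1" using q assms(2) by simp
    from generic_parameters.bij_betw_content_value[OF generic_parameters_complex[OF p this]]
    show ?thesis by (rule bij_betw_std_tableaux)
  qed
qed

end
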